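(* Let $\pi : E \to B$ be a fibred manifold with fibres $E_x$ and base $B$, with an Ehresmann connection having vertical sub-bundle $V$ and horizontal sub-bundle $H$, and let $P_V$, $P_H$ be the corresponding projectors. Let $N$ be a positive integer. (i) Suppose $\dim(B) = N \dim(E_x)$ and $H = H_1 \oplus \dots \oplus H_N$ with $\dim(H_A) = \dim(V)$ for all $A$. Let $P_A = P_{H_A}$ be the projector onto $H_A$ with kernel $V \oplus \bigoplus_{B \ne A} H_B$. Let $S_A$, $Q_A$ ($A = 1, \dots, N$) be vertical and horizontal endomorphisms, i.e. $(1,1)$ tensor fields on $E$ with $\operatorname{im}(S_A) = V$, $\ker(S_A) = V \oplus \bigoplus_{B \ne A} H_B$, $\operatorname{im}(Q_A) = H_A$, $\ker(Q_A) = H$, $Q_A \circ S_A = P_A$ and $S_A \circ Q_A = P_V$. Put $S := \frac{1}{\sqrt N} \sum_A S_A$, $Q := \frac{1}{\sqrt N} \sum_A Q_A$, and let $\nabla^V_X Y := S([X, Q(Y)])$ for $X, Y \in V$ and $\nabla^A_X Y := Q_A([X, S_A(Y)])$ for $X, Y \in H_A$. Then $E$ has a covariant derivative given, for vector fields $X, Y$ on $E$, by \[ \nabla_X Y := \bar\nabla^V_X (P_V(Y)) + \sum_A \bar\nabla^A_X (P_A(Y)), \] that is, \[ \nabla_X Y = S([P_V(X), Q(Y)]) + \sum_A P_V([P_A(X), P_V(Y)]) + \sum_A \Bigl( Q_A([P_A(X), S_A(Y)]) + P_A([X - P_A(X), P_A(Y)]) \Bigr). \] (ii) Similarly, suppose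 $\dim(E_x) = N \dim(B)$ and $V = V_1 \oplus \dots \oplus V_N$ with $\dim(V_A) = \dim(H)$ for all $A$. Let $P_A = P_{V_A}$ be the projector onto $V_A$ with kernel $H \oplus \bigoplus_{B \ne A} V_B$. Let $S_A$, $Q_A$ be $(1,1)$ tensor fields on $E$ with $\operatorname{im}(S_A) = V_A$, $\ker(S_A) = V$, $\operatorname{im}(Q_A) = H$, $\ker(Q_A) = H \oplus \bigoplus_{B \ne A} V_B$, $S_A \circ Q_A = P_A$ and $Q_A \circ S_A = P_H$. Put $S := \frac{1}{\sqrt N} \sum_A S_A$, $Q := \frac{1}{\sqrt N} \sum_A Q_A$, and let $\nabla^H_X Y := Q([X, S(Y)])$ for $X, Y \in H$ and $\nabla^A_X Y := S_A([X, Q_A(Y)])$ for $X, Y \in V_A$. Then $E$ has a covariant derivative given by \[ \nabla_X Y := \bar\nabla^H_X (P_H(Y)) + \sum_A \bar\nabla^A_X (P_A(Y)), \] that is, \[ \nabla_X Y = Q([P_H(X), S(Y)]) + \sum_A P_H([P_A(X), P_H(Y)]) + \sum_A \Bigl( S_A([P_A(X), Q_A(Y)]) + P_A([X - P_A(X), P_A(Y)]) \Bigr). \]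
   Context: Everything is smooth. For a fibred manifold $\pi : E \to B$, the vertical sub-bundle $V \subset TE$ consists of the tangent spaces to the fibres, and an Ehresmann connection is a horizontal distribution $H \subset TE$ complementary to $V$, so $TE = V \oplus H$ (no completeness condition is imposed). $P_V, P_H$ are the projectors of this direct sum. For a distribution $D$, $\dim(D)$ denotes its rank. A distribution $D$ is identified with the module of vector fields on $E$ with values in $D$, so "$X \in V$" means that $X$ is a vector field with values in $V$. Given a projector $P$ onto a distribution $D$ and an operator $\nabla^D_X Y$ ($X, Y \in D$) with the covariant derivative properties, its extension is \[ \bar\nabla^D_X Y := \nabla^D_{P(X)} Y + P([X - P(X), Y]) \] for arbitrary vector fields $X$ and for $Y \in D$; here $\bar\nabla^V$, $\bar\nabla^H$ and $\bar\nabla^A$ use $P = P_V$, $P = P_H$ and $P = P_A$ respectively. A covariant derivative on $E$ is an affine connection on the manifold $E$: an operator $\nabla_X Y$ on vector fields that is $\mathbb{R}$-linear in both arguments and satisfies $\nabla_{fX} Y = f \nabla_X Y$ and $\nabla_X (fY) = X(f) Y + f \nabla_X Y$ for every smooth function $f$ on $E$. *)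

theory Defs
  imports "HOL-Analysis.Analysis" "HOL-Library.Function_Algebras" "HOL-Library.Set_Algebras"
begin

text \<open>Pointwise scalar multiplication; together with \<^theory>\<open>HOL-Library.Function_Algebras\<close> this
  makes tangent vectors, vector fields and endomorphism fields real vectors, and, together with
  \<^theory>\<open>HOL-Library.Set_Algebras\<close>, it makes \<open>+\<close> and \<open>\<Sum>\<close> on distributions the
  fibrewise sum of subspaces.\<close>

instantiation "fun" :: (type, real_vector) real_vector
begin

definition scaleR_fun_def: "r *\<^sub>R f = (\<lambda>x. r *\<^sub>R f x)"

instance
  by standard (auto simp: scaleR_fun_def fun_eq_iff scaleR_add_right scaleR_add_left)

end

section \<open>Smooth manifolds and smooth maps\<close>

text \<open>\<open>C\<^sup>k\<close> functions on an open subset \<open>U\<close> of a finite-dimensional space.\<close>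

primrec Ck_on :: "nat \<Rightarrow> 'a::real_normed_vector set \<Rightarrow> ('a \<Rightarrow> 'b::real_normed_vector) \<Rightarrow> bool" where
  "Ck_on 0 U f \<longleftrightarrow> continuous_on U f"
| "Ck_on (Suc k) U f \<longleftrightarrow> (\<forall>x\<in>U. f differentiable (at x)) \<and>
     (\<forall>v. Ck_on k U (\<lambda>x. frechet_derivative f (at x) v))"

definition smooth_on :: "'a::real_normed_vector set \<Rightarrow> ('a \<Rightarrow> 'b::real_normed_vector) \<Rightarrow> bool" where
  "smooth_on U f \<longleftrightarrow> (\<forall>k. Ck_on k U f)"

text \<open>A chart \<open>(U, \<phi>)\<close> is a domain with a homeomorphism onto an open subset of the model
  space; \<open>\<phi>\<close> is irrelevant outside \<open>U\<close>.\<close>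

type_synonym ('e, 'm) chart = "'e set \<times> ('e \<Rightarrow> 'm)"

definition is_chart :: "('e::topological_space, 'm::real_normed_vector) chart \<Rightarrow> bool" where
  "is_chart c \<longleftrightarrow> open (fst c) \<and> open (snd c ` fst c) \<and>
     (\<exists>\<psi>. homeomorphism (fst c) (snd c ` fst c) (snd c) \<psi>)"

definition chart_inv :: "('e, 'm) chart \<Rightarrow> 'm \<Rightarrow> 'e" where
  "chart_inv c = inv_into (fst c) (snd c)"

text \<open>The underlying space is the whole type \<open>'e\<close> (Hausdorff and second countable). The model space
  is a finite-dimensional normed space rather than a type of class \<open>euclidean_space\<close>, so that
  dimension 0 is not excluded. The atlas need not be maximal.\<close>

definition smooth_manifold ::
  "('e::{t2_space, second_countable_topology}, 'm::real_normed_vector) chart set \<Rightarrow> bool" where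
  "smooth_manifold \<A> \<longleftrightarrow>
     (\<exists>S::'m set. finite S \<and> span S = UNIV) \<and>
     (\<forall>c\<in>\<A>. is_chart c) \<and> (\<Union>c\<in>\<A>. fst c) = UNIV \<and>
     (\<forall>c\<in>\<A>. \<forall>d\<in>\<A>. smooth_on (snd c ` (fst c \<inter> fst d)) (snd d \<circ> chart_inv c))"

definition manifold_dim :: "('e, 'm::real_normed_vector) chart set \<Rightarrow> nat" where
  "manifold_dim \<A> = dim (UNIV :: 'm set)"

definition std_atlas :: "('m::real_normed_vector, 'm) chart set" where
  "std_atlas = {(UNIV, \<lambda>x. x)}"

definition smooth_map ::
  "('e::topological_space, 'm::real_normed_vector) chart set \<Rightarrow>
   ('b::topological_space, 'n::real_normed_vector) chart set \<Rightarrow> ('e \<Rightarrow> 'b) \<Rightarrow> bool" where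
  "smooth_map \<A> \<B> f \<longleftrightarrow> continuous_on UNIV f \<and>
     (\<forall>c\<in>\<A>. \<forall>d\<in>\<B>. smooth_on (snd c ` (fst c \<inter> f -` fst d)) (snd d \<circ> f \<circ> chart_inv c))"

definition smooth_funs ::
  "('e::topological_space, 'm::real_normed_vector) chart set \<Rightarrow> ('e \<Rightarrow> real) set" where
  "smooth_funs \<A> = {f. smooth_map \<A> std_atlas f}"

section \<open>Tangent vectors\<close>

text \<open>Tangent vectors at \<open>p\<close> are derivations at \<open>p\<close> of the algebra of smooth functions,
  extended by 0 to non-smooth functions, so that equality of tangent vectors is equality on
  smooth functions.\<close>

type_synonym 'e tvec = "('e \<Rightarrow> real) \<Rightarrow> real"

definition tangent_space ::
  "('e::topological_space, 'm::real_normed_vector) chart set \<Rightarrow> 'e \<Rightarrow> 'e tvec set" where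
  "tangent_space \<A> p = {v.
     (\<forall>f. f \<notin> smooth_funs \<A> \<longrightarrow> v f = 0) \<and>
     (\<forall>f\<in>smooth_funs \<A>. \<forall>g\<in>smooth_funs \<A>. v (\<lambda>x. f x + g x) = v f + v g) \<and>
     (\<forall>f\<in>smooth_funs \<A>. \<forall>c. v (\<lambda>x. c * f x) = c * v f) \<and>
     (\<forall>f\<in>smooth_funs \<A>. \<forall>g\<in>smooth_funs \<A>. v (\<lambda>x. f x * g x) = f p * v g + g p * v f)}"

definition tangent_map ::
  "('e::topological_space, 'm::real_normed_vector) chart set \<Rightarrow>
   ('b::topological_space, 'n::real_normed_vector) chart set \<Rightarrow> ('e \<Rightarrow> 'b) \<Rightarrow> 'e tvec \<Rightarrow> 'b tvec" where
  "tangent_map \<A> \<B> \<pi> v = (\<lambda>g. if g \<in> smooth_funs \<B> then v (g \<circ> \<pi>) else 0)"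

definition fibred_manifold ::
  "('e::{t2_space, second_countable_topology}, 'm::real_normed_vector) chart set \<Rightarrow>
   ('b::{t2_space, second_countable_topology}, 'n::real_normed_vector) chart set \<Rightarrow>
   ('e \<Rightarrow> 'b) \<Rightarrow> bool" where
  "fibred_manifold \<A> \<B> \<pi> \<longleftrightarrow> smooth_manifold \<A> \<and> smooth_manifold \<B> \<and>
     smooth_map \<A> \<B> \<pi> \<and> surj \<pi> \<and>
     (\<forall>p. tangent_map \<A> \<B> \<pi> ` tangent_space \<A> p = tangent_space \<B> (\<pi> p))"

definition fibre :: "('e \<Rightarrow> 'b) \<Rightarrow> 'b \<Rightarrow> 'e set" where
  "fibre \<pi> x = {p. \<pi> p = x}"

definition velocity ::
  "('e::topological_space, 'm::real_normed_vector) chart set \<Rightarrow> (real \<Rightarrow> 'e) \<Rightarrow> 'e tvec" where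
  "velocity \<A> \<gamma> = (\<lambda>f. if f \<in> smooth_funs \<A> then deriv (f \<circ> \<gamma>) 0 else 0)"

text \<open>The tangent space at \<open>p\<close> of an embedded submanifold \<open>F\<close>, as a subspace of the ambient
  tangent space: velocities of smooth curves in \<open>F\<close>. Curves may be taken to be defined on all
  of the real line, as only their germ at 0 matters.\<close>

definition submanifold_tangent_space ::
  "('e::topological_space, 'm::real_normed_vector) chart set \<Rightarrow> 'e set \<Rightarrow> 'e \<Rightarrow> 'e tvec set" where
  "submanifold_tangent_space \<A> F p =
     {velocity \<A> \<gamma> | \<gamma>. smooth_map std_atlas \<A> \<gamma> \<and> \<gamma> 0 = p \<and> range \<gamma> \<subseteq> F}"

section \<open>Vector fields, distributions and endomorphisms\<close>

type_synonym 'e vfield = "'e \<Rightarrow> 'e tvec"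
type_synonym 'e distr = "'e \<Rightarrow> 'e tvec set"
type_synonym 'e endo = "'e \<Rightarrow> 'e tvec \<Rightarrow> 'e tvec"

definition vfields ::
  "('e::topological_space, 'm::real_normed_vector) chart set \<Rightarrow> 'e vfield set" where
  "vfields \<A> = {X. (\<forall>p. X p \<in> tangent_space \<A> p) \<and>
     (\<forall>f\<in>smooth_funs \<A>. (\<lambda>p. X p f) \<in> smooth_funs \<A>)}"

definition lie_bracket ::
  "('e::topological_space, 'm::real_normed_vector) chart set \<Rightarrow>
   'e vfield \<Rightarrow> 'e vfield \<Rightarrow> 'e vfield" where
  "lie_bracket \<A> X Y = (\<lambda>p f. if f \<in> smooth_funs \<A>
     then X p (\<lambda>q. Y q f) - Y p (\<lambda>q. X q f) else 0)"

text \<open>Smooth distributions of rank \<open>k\<close>: locally spanned by \<open>k\<close> smooth vector fields. The local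
  frame may be taken to consist of global vector fields, by shrinking \<open>U\<close> and using bump
  functions.\<close>

definition distribution ::
  "('e::topological_space, 'm::real_normed_vector) chart set \<Rightarrow> nat \<Rightarrow> 'e distr \<Rightarrow> bool" where
  "distribution \<A> k D \<longleftrightarrow>
     (\<forall>p. subspace (D p) \<and> D p \<subseteq> tangent_space \<A> p \<and> dim (D p) = k) \<and>
     (\<forall>p. \<exists>U X. open U \<and> p \<in> U \<and> (\<forall>i<k. X i \<in> vfields \<A>) \<and>
        (\<forall>q\<in>U. D q = span {X i q | i. i < k}))"

text \<open>Smooth (1,1) tensor fields: fibrewise linear maps of the tangent bundle that preserve
  smoothness of vector fields.\<close>

definition endomorphism ::
  "('e::topological_space, 'm::real_normed_vector) chart set \<Rightarrow> 'e endo \<Rightarrow> bool" where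
  "endomorphism \<A> T \<longleftrightarrow>
     (\<forall>p. \<forall>v\<in>tangent_space \<A> p. T p v \<in> tangent_space \<A> p) \<and>
     (\<forall>p. \<forall>v\<in>tangent_space \<A> p. \<forall>w\<in>tangent_space \<A> p. T p (v + w) = T p v + T p w) \<and>
     (\<forall>p. \<forall>v\<in>tangent_space \<A> p. \<forall>c. T p (c *\<^sub>R v) = c *\<^sub>R T p v) \<and>
     (\<forall>X\<in>vfields \<A>. (\<lambda>p. T p (X p)) \<in> vfields \<A>)"

definition endo_im ::
  "('e::topological_space, 'm::real_normed_vector) chart set \<Rightarrow> 'e endo \<Rightarrow> 'e distr" where
  "endo_im \<A> T p = T p ` tangent_space \<A> p"

definition endo_ker ::
  "('e::topological_space, 'm::real_normed_vector) chart set \<Rightarrow> 'e endo \<Rightarrow> 'e distr" where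
  "endo_ker \<A> T p = {v \<in> tangent_space \<A> p. T p v = 0}"

text \<open>Values of an endomorphism field on non-tangent vectors are irrelevant, so equality of
  \<open>T \<circ> T'\<close> and \<open>P\<close> is only required on tangent vectors.\<close>

definition endo_comp_eq ::
  "('e::topological_space, 'm::real_normed_vector) chart set \<Rightarrow>
   'e endo \<Rightarrow> 'e endo \<Rightarrow> 'e endo \<Rightarrow> bool" where
  "endo_comp_eq \<A> T T' P \<longleftrightarrow> (\<forall>p. \<forall>v\<in>tangent_space \<A> p. T p (T' p v) = P p v)"

definition endo_app :: "'e endo \<Rightarrow> 'e vfield \<Rightarrow> 'e vfield" (infixr \<open>\<cdot>\<close> 75) where
  "T \<cdot> X = (\<lambda>p. T p (X p))"

text \<open>The projector onto \<open>D\<close> with kernel \<open>K\<close>, for complementary \<open>D\<close> and \<open>K\<close>.\<close>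

definition projector :: "'e distr \<Rightarrow> 'e distr \<Rightarrow> 'e endo" where
  "projector D K p v = (THE w. w \<in> D p \<and> v - w \<in> K p)"

text \<open>\<open>D = \<Oplus>\<^sub>i\<^sub>\<in>\<^sub>I W\<^sub>i\<close>; note that the sum on the right is the fibrewise sum of subspaces.\<close>

definition direct_sum :: "'e distr \<Rightarrow> ('i \<Rightarrow> 'e distr) \<Rightarrow> 'i set \<Rightarrow> bool" where
  "direct_sum D W I \<longleftrightarrow> D = (\<Sum>i\<in>I. W i) \<and>
     (\<forall>i\<in>I. \<forall>p. W i p \<inter> (\<Sum>j\<in>I - {i}. W j) p = {0})"

section \<open>Connections\<close>

definition vertical ::
  "('e::topological_space, 'm::real_normed_vector) chart set \<Rightarrow> ('e \<Rightarrow> 'b) \<Rightarrow> 'e distr" where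
  "vertical \<A> \<pi> p = submanifold_tangent_space \<A> (fibre \<pi> (\<pi> p)) p"

definition ehresmann_connection ::
  "('e::topological_space, 'm::real_normed_vector) chart set \<Rightarrow> ('e \<Rightarrow> 'b) \<Rightarrow> 'e distr \<Rightarrow> bool" where
  "ehresmann_connection \<A> \<pi> H \<longleftrightarrow> (\<exists>k. distribution \<A> k H) \<and>
     tangent_space \<A> = vertical \<A> \<pi> + H \<and> (\<forall>p. vertical \<A> \<pi> p \<inter> H p = {0})"

definition fmul :: "('e \<Rightarrow> real) \<Rightarrow> 'e vfield \<Rightarrow> 'e vfield" where
  "fmul f X = (\<lambda>p. f p *\<^sub>R X p)"

definition covariant_derivative ::
  "('e::topological_space, 'm::real_normed_vector) chart set \<Rightarrow>
   ('e vfield \<Rightarrow> 'e vfield \<Rightarrow> 'e vfield) \<Rightarrow> bool" where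
  "covariant_derivative \<A> D \<longleftrightarrow>
     (\<forall>X\<in>vfields \<A>. \<forall>Y\<in>vfields \<A>. D X Y \<in> vfields \<A>) \<and>
     (\<forall>X\<in>vfields \<A>. \<forall>X'\<in>vfields \<A>. \<forall>Y\<in>vfields \<A>. D (X + X') Y = D X Y + D X' Y) \<and>
     (\<forall>X\<in>vfields \<A>. \<forall>Y\<in>vfields \<A>. \<forall>Y'\<in>vfields \<A>. D X (Y + Y') = D X Y + D X Y') \<and>
     (\<forall>X\<in>vfields \<A>. \<forall>Y\<in>vfields \<A>. \<forall>c. D (c *\<^sub>R X) Y = c *\<^sub>R D X Y \<and> D X (c *\<^sub>R Y) = c *\<^sub>R D X Y) \<and>
     (\<forall>X\<in>vfields \<A>. \<forall>Y\<in>vfields \<A>. \<forall>f\<in>smooth_funs \<A>. D (fmul f X) Y = fmul f (D X Y)) \<and>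
     (\<forall>X\<in>vfields \<A>. \<forall>Y\<in>vfields \<A>. \<forall>f\<in>smooth_funs \<A>.
        D X (fmul f Y) = fmul (\<lambda>p. X p f) Y + fmul f (D X Y))"

text \<open>The extension of an operator \<open>D\<close> on sections of
  the image of \<open>P\<close> to arbitrary first arguments.\<close>

definition extension ::
  "('e::topological_space, 'm::real_normed_vector) chart set \<Rightarrow> 'e endo \<Rightarrow>
   ('e vfield \<Rightarrow> 'e vfield \<Rightarrow> 'e vfield) \<Rightarrow> 'e vfield \<Rightarrow> 'e vfield \<Rightarrow> 'e vfield" where
  "extension \<A> P D X Y = D (P \<cdot> X) Y + P \<cdot> lie_bracket \<A> (X - P \<cdot> X) Y"

end

theory Submission
  imports Defs
begin

text \<open>Part (ii) is part (i) with \<open>(V, S\<^sub>A)\<close> and \<open>(H, Q\<^sub>A)\<close> interchanged, so it suffices to treat a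
  splitting \<open>TE = W \<oplus> Z\<close>, \<open>Z = \<Oplus> Z\<^sub>A\<close>. The image and kernel conditions give \<open>S\<^sub>A S\<^sub>B = Q\<^sub>A Q\<^sub>B = 0\<close> and
  \<open>S\<^sub>A Q\<^sub>B = 0\<close> for \<open>A \<noteq> B\<close>, and the projectors \<open>P\<^sub>A = Q\<^sub>A S\<^sub>A\<close>, \<open>P\<^sub>W = S\<^sub>A Q\<^sub>A\<close> are
  smooth endomorphisms with sum \<open>P\<^sub>W + \<Sum> P\<^sub>A = 1\<close>.
  An operator \<open>\<nabla>\<^sub>X Y = L [X, M Y]\<close> on the image of \<open>P\<close> is tensorial in \<open>X\<close> because \<open>L P = 0\<close> and
  satisfies the Leibniz rule in \<open>Y\<close> because \<open>L M P = P\<close>. For \<open>L = S\<close>, \<open>M = Q\<close> the latter is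
  \<open>S Q = (1/N) \<Sum> S\<^sub>A Q\<^sub>A = P\<^sub>W\<close>, which is where the factors \<open>1/\<surd>N\<close> come from.\<close>

section \<open>The algebra of smooth functions\<close>

lemma Ck_on_continuous_on: "Ck_on k U f \<Longrightarrow> continuous_on U f"
  by (cases k)
    (auto intro!: continuous_at_imp_continuous_on differentiable_imp_continuous_within)

lemma Ck_on_Suc_imp: "Ck_on (Suc k) U f \<Longrightarrow> Ck_on k U f"
proof (induction k arbitrary: f)
  case 0
  then show ?case unfolding Ck_on.simps(1) by (rule Ck_on_continuous_on)
next
  case (Suc k)
  then show ?case by (metis Ck_on.simps(2))
qed

text \<open>On an open set the derivative at a point depends only on nearby values, so it agrees for
  \<open>f\<close> and \<open>g\<close>, and the induction passes to directional derivatives. This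
  allows \<open>frechet_derivative\<close> of a sum or product to be replaced by its explicit
  formula.\<close>

lemma Ck_on_cong:
  assumes "open U" and "\<And>x. x \<in> U \<Longrightarrow> f x = g x" and "Ck_on k U f"
  shows "Ck_on k U g"
  using assms(2,3)
proof (induction k arbitrary: f g)
  case 0
  then show ?case using continuous_on_cong[of U U f g] by simp
next
  case (Suc k)
  have der: "(g has_derivative frechet_derivative f (at x)) (at x)" if "x \<in> U" for x
    by (rule has_derivative_transform_within_open[OF _ assms(1) that Suc.prems(1)])
      (use Suc.prems(2) that in \<open>auto simp: frechet_derivative_works\<close>)
  have "Ck_on k U (\<lambda>x. frechet_derivative g (at x) v)" for v
  proof (rule Suc.IH)
    show "frechet_derivative f (at x) v = frechet_derivative g (at x) v" if "x \<in> U" for x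
      using frechet_derivative_at[OF der[OF that]] by metis
    show "Ck_on k U (\<lambda>x. frechet_derivative f (at x) v)"
      using Suc.prems(2) by simp
  qed
  then show ?case using der by (auto simp: differentiable_def)
qed

lemma Ck_on_const: "Ck_on k U (\<lambda>x. c)"
  by (induction k arbitrary: c) auto

lemma Ck_on_add:
  assumes "open U" and "Ck_on k U f" and "Ck_on k U g"
  shows "Ck_on k U (\<lambda>x. f x + g x)"
  using assms(2,3)
proof (induction k arbitrary: f g)
  case 0
  then show ?case by (auto intro: continuous_on_add)
next
  case (Suc k)
  have der: "((\<lambda>x. f x + g x) has_derivative
      (\<lambda>v. frechet_derivative f (at x) v + frechet_derivative g (at x) v)) (at x)"
    if "x \<in> U" for x
    using Suc.prems that by (auto intro!: has_derivative_add simp: frechet_derivative_works)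
  have "Ck_on k U (\<lambda>x. frechet_derivative (\<lambda>x. f x + g x) (at x) v)" for v
    by (rule Ck_on_cong[OF assms(1) _ Suc.IH])
      (use Suc.prems frechet_derivative_at[OF der, symmetric] in auto)
  then show ?case using der by (auto simp: differentiable_def)
qed

text \<open>The derivative of a product is a sum of products, each with one undifferentiated factor;
  \<open>Ck_on_Suc_imp\<close> lowers the order of that factor so that the induction hypothesis
  applies.\<close>

lemma Ck_on_mult:
  fixes f g :: "'a::real_normed_vector \<Rightarrow> 'b::real_normed_algebra"
  assumes "open U" and "Ck_on k U f" and "Ck_on k U g"
  shows "Ck_on k U (\<lambda>x. f x * g x)"
  using assms(2,3)
proof (induction k arbitrary: f g)
  case 0
  then show ?case by (auto intro: continuous_on_mult)
next
  case (Suc k)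
  have der: "((\<lambda>x. f x * g x) has_derivative
      (\<lambda>v. f x * frechet_derivative g (at x) v + frechet_derivative f (at x) v * g x)) (at x)"
    if "x \<in> U" for x
    using Suc.prems that by (auto intro!: has_derivative_mult simp: frechet_derivative_works)
  have "Ck_on k U (\<lambda>x. f x * frechet_derivative g (at x) v + frechet_derivative f (at x) v * g x)"
    for v
    using Suc.prems Ck_on_Suc_imp[OF Suc.prems(1)] Ck_on_Suc_imp[OF Suc.prems(2)]
    by (intro Ck_on_add[OF assms(1)] Suc.IH) auto
  then have "Ck_on k U (\<lambda>x. frechet_derivative (\<lambda>x. f x * g x) (at x) v)" for v
    by (rule Ck_on_cong[OF assms(1), rotated])
      (use frechet_derivative_at[OF der, symmetric] in auto)
  then show ?case using der by (auto simp: differentiable_def)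
qed

text \<open>The identity on the whole line is the only chart of the target, so the preimages of
  chart domains disappear and only the charts of \<open>E\<close> remain.\<close>

lemma smooth_funs_iff:
  "f \<in> smooth_funs E \<longleftrightarrow>
     continuous_on UNIV f \<and> (\<forall>c\<in>E. \<forall>k. Ck_on k (snd c ` fst c) (\<lambda>x. f (chart_inv c x)))"
  by (simp add: smooth_funs_def smooth_map_def std_atlas_def smooth_on_def comp_def)

lemma smooth_manifold_open:
  "smooth_manifold E \<Longrightarrow> c \<in> E \<Longrightarrow> open (snd c ` fst c)"
  by (auto simp: smooth_manifold_def is_chart_def)

lemma smooth_funs_const: "(\<lambda>x. c) \<in> smooth_funs E"
  by (simp add: smooth_funs_iff Ck_on_const)

lemma smooth_funs_add:
  "smooth_manifold E \<Longrightarrow> f \<in> smooth_funs E \<Longrightarrow> g \<in> smooth_funs E \<Longrightarrow>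
    (\<lambda>x. f x + g x) \<in> smooth_funs E"
  by (simp add: smooth_funs_iff Ck_on_add smooth_manifold_open continuous_on_add)

lemma smooth_funs_mult:
  "smooth_manifold E \<Longrightarrow> f \<in> smooth_funs E \<Longrightarrow> g \<in> smooth_funs E \<Longrightarrow>
    (\<lambda>x. f x * g x) \<in> smooth_funs E"
  by (simp add: smooth_funs_iff Ck_on_mult smooth_manifold_open continuous_on_mult)

lemma smooth_funs_diff:
  assumes "smooth_manifold E" and "f \<in> smooth_funs E" and "g \<in> smooth_funs E"
  shows "(\<lambda>x. f x - g x) \<in> smooth_funs E"
  using smooth_funs_add[OF assms(1,2) smooth_funs_mult[OF assms(1) smooth_funs_const[of "-1"] assms(3)]]
  by simp

section \<open>Tangent vectors, vector fields and the Lie bracket\<close>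

lemma sum_fun_apply: "(\<Sum>i\<in>I. f i) x = (\<Sum>i\<in>I. f i x)"
  by (induction I rule: infinite_finite_induct) auto

lemma subspace_tangent_space: "subspace (tangent_space E p)"
  unfolding subspace_def tangent_space_def
  by (auto simp: scaleR_fun_def algebra_simps)

lemma tangent_spaceD:
  assumes "v \<in> tangent_space E p"
  shows "f \<notin> smooth_funs E \<Longrightarrow> v f = 0"
    and "f \<in> smooth_funs E \<Longrightarrow> g \<in> smooth_funs E \<Longrightarrow> v (\<lambda>x. f x + g x) = v f + v g"
    and "f \<in> smooth_funs E \<Longrightarrow> v (\<lambda>x. c * f x) = c * v f"
    and "f \<in> smooth_funs E \<Longrightarrow> g \<in> smooth_funs E \<Longrightarrow> v (\<lambda>x. f x * g x) = f p * v g + g p * v f"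
  using assms by (auto simp: tangent_space_def)

text \<open>The Leibniz rule for the product 1 * 1 shows that \<open>v\<close> doubles its own value
  at the constant 1, so this value is 0; homogeneity carries this over to \<open>c\<close>.\<close>

lemma tangent_space_const:
  assumes "v \<in> tangent_space E p"
  shows "v (\<lambda>x. c) = 0"
  using tangent_spaceD(4)[OF assms smooth_funs_const[of 1] smooth_funs_const[of 1]]
    tangent_spaceD(3)[OF assms smooth_funs_const[of 1], of c]
  by simp

lemma vfieldsD:
  assumes "X \<in> vfields E"
  shows "X p \<in> tangent_space E p" and "f \<in> smooth_funs E \<Longrightarrow> (\<lambda>p. X p f) \<in> smooth_funs E"
  using assms by (auto simp: vfields_def)

lemma vfields_add:
  assumes "smooth_manifold E" "X \<in> vfields E" "Y \<in> vfields E"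
  shows "X + Y \<in> vfields E"
  using assms by (auto simp: vfields_def smooth_funs_add subspace_add[OF subspace_tangent_space])

lemma vfields_diff:
  assumes "smooth_manifold E" "X \<in> vfields E" "Y \<in> vfields E"
  shows "X - Y \<in> vfields E"
  using assms by (auto simp: vfields_def smooth_funs_diff subspace_diff[OF subspace_tangent_space])

lemma vfields_fmul:
  assumes "smooth_manifold E" "f \<in> smooth_funs E" "X \<in> vfields E"
  shows "fmul f X \<in> vfields E"
  using assms
  by (auto simp: vfields_def fmul_def smooth_funs_mult subspace_scale[OF subspace_tangent_space])
    (simp add: scaleR_fun_def smooth_funs_mult)

lemma vfields_zero: "0 \<in> vfields E"
  by (auto simp: vfields_def subspace_0[OF subspace_tangent_space] smooth_funs_const)

lemma vfields_sum:
  "smooth_manifold E \<Longrightarrow> (\<And>i. i \<in> I \<Longrightarrow> X i \<in> vfields E) \<Longrightarrow> (\<Sum>i\<in>I. X i) \<in> vfields E"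
  by (induction I rule: infinite_finite_induct) (auto simp: vfields_zero vfields_add)

text \<open>In the Leibniz rule the cross terms, products of a derivative of \<open>f\<close> and a
  derivative of \<open>g\<close>, cancel between the two composites. Since
  \<open>\<lambda>q. X q f\<close> and \<open>\<lambda>q. Y q f\<close> are again smooth, the
  derivation rules can be applied a second time.\<close>

lemma lie_bracket_vfields:
  assumes E: "smooth_manifold E" and X: "X \<in> vfields E" and Y: "Y \<in> vfields E"
  shows "lie_bracket E X Y \<in> vfields E"
proof -
  note X' = vfieldsD[OF X] and Y' = vfieldsD[OF Y]
  note sm = smooth_funs_add[OF E] smooth_funs_mult[OF E] smooth_funs_diff[OF E] smooth_funs_const
  have "lie_bracket E X Y p \<in> tangent_space E p" for p
    unfolding tangent_space_def mem_Collect_eq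
  proof (intro conjI ballI allI impI)
    fix f g c assume f: "f \<in> smooth_funs E"
    show "lie_bracket E X Y p (\<lambda>x. c * f x) = c * lie_bracket E X Y p f"
      using f by (simp add: lie_bracket_def sm tangent_spaceD(3)[OF X'(1)]
          tangent_spaceD(3)[OF Y'(1)] X'(2) Y'(2) algebra_simps)
    assume g: "g \<in> smooth_funs E"
    show "lie_bracket E X Y p (\<lambda>x. f x + g x) = lie_bracket E X Y p f + lie_bracket E X Y p g"
      using f g by (simp add: lie_bracket_def sm tangent_spaceD(2)[OF X'(1)]
          tangent_spaceD(2)[OF Y'(1)] X'(2) Y'(2))
    show "lie_bracket E X Y p (\<lambda>x. f x * g x) =
        f p * lie_bracket E X Y p g + g p * lie_bracket E X Y p f"
      using f g by (simp add: lie_bracket_def sm tangent_spaceD(2,4)[OF X'(1)]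
          tangent_spaceD(2,4)[OF Y'(1)] X'(2) Y'(2) algebra_simps)
  qed (simp add: lie_bracket_def)
  then show ?thesis
    using X' Y' by (auto simp: vfields_def lie_bracket_def sm)
qed

lemma lie_bracket_add_left:
  assumes "smooth_manifold E" "X \<in> vfields E" "X' \<in> vfields E" "Y \<in> vfields E"
  shows "lie_bracket E (X + X') Y = lie_bracket E X Y + lie_bracket E X' Y"
  using assms
  by (auto simp: lie_bracket_def fun_eq_iff tangent_spaceD(2)[OF vfieldsD(1)[OF assms(4)]] vfieldsD(2))

lemma lie_bracket_add_right:
  assumes "smooth_manifold E" "X \<in> vfields E" "Y \<in> vfields E" "Y' \<in> vfields E"
  shows "lie_bracket E X (Y + Y') = lie_bracket E X Y + lie_bracket E X Y'"
  using assms
  by (auto simp: lie_bracket_def fun_eq_iff tangent_spaceD(2)[OF vfieldsD(1)[OF assms(2)]] vfieldsD(2))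

lemma lie_bracket_zero_left: "Y \<in> vfields E \<Longrightarrow> lie_bracket E 0 Y = 0"
  by (auto simp: lie_bracket_def fun_eq_iff tangent_space_const[OF vfieldsD(1)])

lemma lie_bracket_sum_left:
  assumes "smooth_manifold E" and "\<And>i. i \<in> I \<Longrightarrow> X i \<in> vfields E" and "Y \<in> vfields E"
  shows "lie_bracket E (\<Sum>i\<in>I. X i) Y = (\<Sum>i\<in>I. lie_bracket E (X i) Y)"
  using assms(2)
  by (induction I rule: infinite_finite_induct)
    (auto simp: lie_bracket_zero_left assms(1,3) lie_bracket_add_left vfields_sum)

text \<open>The equation has to hold at all functions, smooth or not. At a non-smooth one the
  brackets vanish by definition, and the term with \<open>X\<close> vanishes by
  \<open>tangent_spaceD(1)\<close>.\<close>

lemma lie_bracket_fmul_left: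
  assumes "smooth_manifold E" "X \<in> vfields E" "Y \<in> vfields E" "f \<in> smooth_funs E"
  shows "lie_bracket E (fmul f X) Y = fmul f (lie_bracket E X Y) - fmul (\<lambda>p. Y p f) X"
  using assms
  by (auto simp: lie_bracket_def fmul_def scaleR_fun_def fun_eq_iff vfieldsD(2) algebra_simps
      tangent_spaceD(1)[OF vfieldsD(1)[of _ E]] tangent_spaceD(4)[OF vfieldsD(1)[OF assms(3)]])

lemma lie_bracket_fmul_right:
  assumes "smooth_manifold E" "X \<in> vfields E" "Y \<in> vfields E" "f \<in> smooth_funs E"
  shows "lie_bracket E X (fmul f Y) = fmul (\<lambda>p. X p f) Y + fmul f (lie_bracket E X Y)"
  using assms
  by (auto simp: lie_bracket_def fmul_def scaleR_fun_def fun_eq_iff vfieldsD(2) algebra_simps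
      tangent_spaceD(1)[OF vfieldsD(1)[of _ E]] tangent_spaceD(4)[OF vfieldsD(1)[OF assms(2)]])

section \<open>Endomorphism fields\<close>

lemma endomorphismD:
  assumes "endomorphism E T"
  shows "v \<in> tangent_space E p \<Longrightarrow> T p v \<in> tangent_space E p"
    and "v \<in> tangent_space E p \<Longrightarrow> w \<in> tangent_space E p \<Longrightarrow> T p (v + w) = T p v + T p w"
    and "v \<in> tangent_space E p \<Longrightarrow> T p (c *\<^sub>R v) = c *\<^sub>R T p v"
    and "X \<in> vfields E \<Longrightarrow> T \<cdot> X \<in> vfields E"
  using assms by (auto simp: endomorphism_def endo_app_def)

lemma endomorphism_zero_apply: "endomorphism E T \<Longrightarrow> T p 0 = 0"
  using endomorphismD(3)[of E T 0 p 0] subspace_0[OF subspace_tangent_space] by auto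

lemma endomorphism_diff:
  assumes "endomorphism E T" "v \<in> tangent_space E p" "w \<in> tangent_space E p"
  shows "T p (v - w) = T p v - T p w"
  using endomorphismD(2)[OF assms(1) subspace_diff[OF subspace_tangent_space assms(2,3)] assms(3)]
  by (simp add: eq_diff_eq)

lemma endomorphism_sum_apply:
  assumes "endomorphism E T" "\<And>i. i \<in> I \<Longrightarrow> v i \<in> tangent_space E p"
  shows "T p (\<Sum>i\<in>I. v i) = (\<Sum>i\<in>I. T p (v i))"
  using assms(2)
  by (induction I rule: infinite_finite_induct)
    (auto simp: endomorphism_zero_apply[OF assms(1)] endomorphismD(2)[OF assms(1)]
      subspace_sum[OF subspace_tangent_space])

lemma endomorphism_zero: "endomorphism E 0"
proof -
  have "(\<lambda>p. 0) \<in> vfields E"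
    using vfields_zero[of E] by (simp add: zero_fun_def)
  then show ?thesis
    by (simp add: endomorphism_def subspace_0[OF subspace_tangent_space])
qed

lemma endomorphism_add:
  assumes "smooth_manifold E" "endomorphism E T" "endomorphism E T'"
  shows "endomorphism E (T + T')"
proof -
  have "(\<lambda>p. T p (X p) + T' p (X p)) \<in> vfields E" if "X \<in> vfields E" for X
    using vfields_add[OF assms(1) endomorphismD(4)[OF assms(2) that] endomorphismD(4)[OF assms(3) that]]
    by (simp add: endo_app_def plus_fun_def)
  then show ?thesis
    by (simp add: endomorphism_def endomorphismD(1-3)[OF assms(2)] endomorphismD(1-3)[OF assms(3)]
        scaleR_add_right subspace_add[OF subspace_tangent_space])
qed

lemma endomorphism_sum:
  "smooth_manifold E \<Longrightarrow> (\<And>i. i \<in> I \<Longrightarrow> endomorphism E (T i)) \<Longrightarrow> endomorphism E (\<Sum>i\<in>I. T i)"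
  by (induction I rule: infinite_finite_induct) (auto simp: endomorphism_zero endomorphism_add)

lemma endomorphism_scaleR:
  assumes "smooth_manifold E" "endomorphism E T"
  shows "endomorphism E (c *\<^sub>R T)"
proof -
  have app: "(c *\<^sub>R T) p v = c *\<^sub>R T p v" for p v
    by (simp add: scaleR_fun_def)
  have "(\<lambda>p. c *\<^sub>R T p (X p)) \<in> vfields E" if "X \<in> vfields E" for X
    using vfields_fmul[OF assms(1) smooth_funs_const endomorphismD(4)[OF assms(2) that], of c]
    by (simp add: fmul_def endo_app_def)
  then show ?thesis
    unfolding endomorphism_def app
    by (auto simp: endomorphismD(1-3)[OF assms(2)] scaleR_add_right
        subspace_scale[OF subspace_tangent_space] mult.commute)
qed

text \<open>A \<open>projector\<close> is defined by a pointwise description that says nothing about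
  smoothness. Writing it as a composite of two smooth endomorphism fields supplies that.\<close>

lemma endomorphism_comp:
  assumes T: "endomorphism E T" and T': "endomorphism E T'" and "endo_comp_eq E T T' P"
  shows "endomorphism E P"
proof -
  have eq: "P p v = T p (T' p v)" if "v \<in> tangent_space E p" for p v
    using assms(3) that by (simp add: endo_comp_eq_def)
  have "(\<lambda>p. P p (X p)) \<in> vfields E" if "X \<in> vfields E" for X
    using endomorphismD(4)[OF T endomorphismD(4)[OF T' that]] eq[OF vfieldsD(1)[OF that]]
    by (simp add: endo_app_def)
  then show ?thesis
    unfolding endomorphism_def
    by (auto simp: eq endomorphismD(1-3)[OF T] endomorphismD(1-3)[OF T']
        subspace_add[OF subspace_tangent_space] subspace_scale[OF subspace_tangent_space])
qed

lemma endo_app_add: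
  assumes "endomorphism E T" "X \<in> vfields E" "Y \<in> vfields E"
  shows "T \<cdot> (X + Y) = T \<cdot> X + T \<cdot> Y"
  using endomorphismD(2)[OF assms(1) vfieldsD(1)[OF assms(2)] vfieldsD(1)[OF assms(3)]]
  by (simp add: endo_app_def fun_eq_iff)

lemma endo_app_diff:
  assumes "endomorphism E T" "X \<in> vfields E" "Y \<in> vfields E"
  shows "T \<cdot> (X - Y) = T \<cdot> X - T \<cdot> Y"
  using endomorphism_diff[OF assms(1) vfieldsD(1)[OF assms(2)] vfieldsD(1)[OF assms(3)]]
  by (simp add: endo_app_def fun_eq_iff)

lemma endo_app_sum:
  assumes "endomorphism E T" "\<And>i. i \<in> I \<Longrightarrow> X i \<in> vfields E"
  shows "T \<cdot> (\<Sum>i\<in>I. X i) = (\<Sum>i\<in>I. T \<cdot> X i)"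
proof
  show "(T \<cdot> (\<Sum>i\<in>I. X i)) p = (\<Sum>i\<in>I. T \<cdot> X i) p" for p
    using endomorphism_sum_apply[OF assms(1), of I "\<lambda>i. X i p" p] vfieldsD(1)[OF assms(2)]
    by (simp add: endo_app_def sum_fun_apply[of _ _ p])
qed

lemma endo_app_fmul:
  assumes "endomorphism E T" "X \<in> vfields E"
  shows "T \<cdot> fmul f X = fmul f (T \<cdot> X)"
  using endomorphismD(3)[OF assms(1) vfieldsD(1)[OF assms(2)]]
  by (simp add: endo_app_def fmul_def)

lemma fmul_add: "fmul f (X + Y) = fmul f X + fmul f Y"
  by (rule ext) (simp add: fmul_def scaleR_add_right)

lemma fmul_diff: "fmul f (X - Y) = fmul f X - fmul f Y"
  by (rule ext) (simp add: fmul_def scaleR_diff_right)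

lemma fmul_zero: "fmul f 0 = 0"
  by (rule ext) (simp add: fmul_def)

section \<open>Partial covariant derivatives\<close>

text \<open>The operators \<open>Y \<mapsto> \<nabla>\<^sub>X (P Y)\<close> for a covariant derivative on the image of \<open>P\<close>; they add up
  to a covariant derivative when the projectors \<open>P\<close> add up to the identity.\<close>

definition partial_cov_deriv ::
  "('e::topological_space, 'm::real_normed_vector) chart set \<Rightarrow> 'e endo \<Rightarrow>
   ('e vfield \<Rightarrow> 'e vfield \<Rightarrow> 'e vfield) \<Rightarrow> bool" where
  "partial_cov_deriv E P D \<longleftrightarrow>
     (\<forall>X\<in>vfields E. \<forall>Y\<in>vfields E. D X Y \<in> vfields E) \<and>
     (\<forall>X\<in>vfields E. \<forall>X'\<in>vfields E. \<forall>Y\<in>vfields E. D (X + X') Y = D X Y + D X' Y) \<and>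
     (\<forall>X\<in>vfields E. \<forall>Y\<in>vfields E. \<forall>Y'\<in>vfields E. D X (Y + Y') = D X Y + D X Y') \<and>
     (\<forall>X\<in>vfields E. \<forall>Y\<in>vfields E. \<forall>f\<in>smooth_funs E. D (fmul f X) Y = fmul f (D X Y)) \<and>
     (\<forall>X\<in>vfields E. \<forall>Y\<in>vfields E. \<forall>f\<in>smooth_funs E.
        D X (fmul f Y) = fmul (\<lambda>p. X p f) (P \<cdot> Y) + fmul f (D X Y))"

lemma partial_cov_deriv_zero: "partial_cov_deriv E 0 0"
  by (simp add: partial_cov_deriv_def vfields_zero endo_app_def fmul_def fun_eq_iff scaleR_fun_def)

lemma partial_cov_deriv_add:
  assumes "smooth_manifold E" "partial_cov_deriv E P D" "partial_cov_deriv E P' D'"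
  shows "partial_cov_deriv E (P + P') (D + D')"
proof -
  have "(P + P') \<cdot> Y = P \<cdot> Y + P' \<cdot> Y" for Y
    by (simp add: endo_app_def fun_eq_iff)
  then show ?thesis
    using assms by (simp add: partial_cov_deriv_def vfields_add fmul_add)
qed

lemma partial_cov_deriv_sum:
  "smooth_manifold E \<Longrightarrow> (\<And>i. i \<in> I \<Longrightarrow> partial_cov_deriv E (P i) (D i)) \<Longrightarrow>
    partial_cov_deriv E (\<Sum>i\<in>I. P i) (\<Sum>i\<in>I. D i)"
  by (induction I rule: infinite_finite_induct)
    (auto simp: partial_cov_deriv_zero partial_cov_deriv_add)

text \<open>Real homogeneity is not a clause of \<open>partial_cov_deriv\<close>; it is the rule for
  \<open>fmul\<close> with a constant function, whose derivative vanishes.\<close>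

lemma covariant_derivative_if_partial:
  assumes D: "partial_cov_deriv E P D" and P: "\<And>Y. Y \<in> vfields E \<Longrightarrow> P \<cdot> Y = Y"
  shows "covariant_derivative E D"
proof -
  have scale: "c *\<^sub>R X = fmul (\<lambda>p. c) X" for c and X :: "'a vfield"
    by (simp add: fmul_def scaleR_fun_def)
  have "fmul (\<lambda>p. X p (\<lambda>q. c)) Y = 0" if "X \<in> vfields E" for X Y c
    using tangent_space_const[OF vfieldsD(1)[OF that]] by (simp add: fmul_def fun_eq_iff)
  then show ?thesis
    using D by (simp add: covariant_derivative_def partial_cov_deriv_def P scale smooth_funs_const)
qed

text \<open>\<open>LP\<close> and \<open>LMP\<close> handle the part along
  \<open>P \<cdot> X\<close>. In the part along \<open>X - P \<cdot> X\<close>, the correction term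
  of the bracket is a multiple of \<open>X - P \<cdot> X\<close>, which \<open>P\<close> annihilates
  by \<open>PP\<close>; in the second argument \<open>PP\<close> leaves the derivative of
  \<open>f\<close> along \<open>X - P \<cdot> X\<close> times \<open>P \<cdot> Y\<close>.\<close>

lemma partial_cov_deriv_extension:
  assumes E: "smooth_manifold E"
    and L: "endomorphism E L" and M: "endomorphism E M" and P: "endomorphism E P"
    and LP: "\<And>p v. v \<in> tangent_space E p \<Longrightarrow> L p (P p v) = 0"
    and LMP: "\<And>p v. v \<in> tangent_space E p \<Longrightarrow> L p (M p (P p v)) = P p v"
    and PP: "\<And>p v. v \<in> tangent_space E p \<Longrightarrow> P p (P p v) = P p v"
  shows "partial_cov_deriv E P
    (\<lambda>X Y. extension E P (\<lambda>X Y. L \<cdot> lie_bracket E X (M \<cdot> Y)) X (P \<cdot> Y))"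
proof -
  note [simp] = E endomorphismD(4)[OF L] endomorphismD(4)[OF M] endomorphismD(4)[OF P]
    lie_bracket_vfields vfields_add vfields_diff vfields_fmul vfieldsD(2) smooth_funs_diff
    endo_app_add[OF L] endo_app_add[OF M] endo_app_add[OF P]
    endo_app_diff[OF L] endo_app_diff[OF M] endo_app_diff[OF P]
    endo_app_fmul[OF L] endo_app_fmul[OF M] endo_app_fmul[OF P]
    lie_bracket_add_left lie_bracket_add_right lie_bracket_fmul_left lie_bracket_fmul_right
  have [simp]: "L \<cdot> P \<cdot> X = 0" "L \<cdot> M \<cdot> P \<cdot> X = P \<cdot> X" "P \<cdot> P \<cdot> X = P \<cdot> X"
    if "X \<in> vfields E" for X
    using vfieldsD(1)[OF that] by (auto simp: endo_app_def LP LMP PP fun_eq_iff)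
  have diff_add: "(X + X') - (Y + Y') = (X - Y) + (X' - Y')" for X X' Y Y' :: "'a vfield"
    by (simp add: algebra_simps)
  \<comment> \<open>The two parts of the extension differentiate \<open>f\<close> only along
    \<open>P \<cdot> X\<close> and along the complement; together they give the full derivative
    along \<open>X\<close>.\<close>
  have *: "fmul (\<lambda>p. (P \<cdot> X) p f) Z + fmul (\<lambda>p. (X - P \<cdot> X) p f) Z = fmul (\<lambda>p. X p f) Z"
    for X Z :: "'a vfield" and f
    by (simp add: fmul_def fun_eq_iff scaleR_fun_def algebra_simps)
  show ?thesis
    unfolding partial_cov_deriv_def extension_def
  proof (intro conjI ballI)
    fix X Y assume [simp]: "X \<in> vfields E" "Y \<in> vfields E"
    show "L \<cdot> lie_bracket E (P \<cdot> X) (M \<cdot> P \<cdot> Y) + P \<cdot> lie_bracket E (X - P \<cdot> X) (P \<cdot> Y) \<in> vfields E"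
      by simp
    show "L \<cdot> lie_bracket E (P \<cdot> (X + X')) (M \<cdot> P \<cdot> Y) + P \<cdot> lie_bracket E (X + X' - P \<cdot> (X + X')) (P \<cdot> Y)
      = L \<cdot> lie_bracket E (P \<cdot> X) (M \<cdot> P \<cdot> Y) + P \<cdot> lie_bracket E (X - P \<cdot> X) (P \<cdot> Y)
      + (L \<cdot> lie_bracket E (P \<cdot> X') (M \<cdot> P \<cdot> Y) + P \<cdot> lie_bracket E (X' - P \<cdot> X') (P \<cdot> Y))"
      if [simp]: "X' \<in> vfields E" for X'
      by (simp add: diff_add)
    show "L \<cdot> lie_bracket E (P \<cdot> X) (M \<cdot> P \<cdot> (Y + Y')) + P \<cdot> lie_bracket E (X - P \<cdot> X) (P \<cdot> (Y + Y'))
      = L \<cdot> lie_bracket E (P \<cdot> X) (M \<cdot> P \<cdot> Y) + P \<cdot> lie_bracket E (X - P \<cdot> X) (P \<cdot> Y)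
      + (L \<cdot> lie_bracket E (P \<cdot> X) (M \<cdot> P \<cdot> Y') + P \<cdot> lie_bracket E (X - P \<cdot> X) (P \<cdot> Y'))"
      if [simp]: "Y' \<in> vfields E" for Y'
      by simp
    fix f assume [simp]: "f \<in> smooth_funs E"
    \<comment> \<open>First \<open>f\<close> is factored out of the difference, so that the bracket
      rule meets a single multiple of \<open>X - P \<cdot> X\<close>; only then is the right-hand
      side expanded.\<close>
    show "L \<cdot> lie_bracket E (P \<cdot> fmul f X) (M \<cdot> P \<cdot> Y) + P \<cdot> lie_bracket E (fmul f X - P \<cdot> fmul f X) (P \<cdot> Y)
      = fmul f (L \<cdot> lie_bracket E (P \<cdot> X) (M \<cdot> P \<cdot> Y) + P \<cdot> lie_bracket E (X - P \<cdot> X) (P \<cdot> Y))"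
      by (simp add: fmul_diff[symmetric]) (simp add: fmul_add fmul_zero)
    show "L \<cdot> lie_bracket E (P \<cdot> X) (M \<cdot> P \<cdot> fmul f Y) + P \<cdot> lie_bracket E (X - P \<cdot> X) (P \<cdot> fmul f Y)
      = fmul (\<lambda>p. X p f) (P \<cdot> Y)
      + fmul f (L \<cdot> lie_bracket E (P \<cdot> X) (M \<cdot> P \<cdot> Y) + P \<cdot> lie_bracket E (X - P \<cdot> X) (P \<cdot> Y))"
      by (simp add: fmul_add *[of X f "P \<cdot> Y", symmetric] ac_simps)
  qed
qed

section \<open>Splittings of the tangent bundle\<close>

text \<open>Vertical spaces are defined by velocities of curves, which does not make their linearity
  evident. Below it comes from their being images of endomorphism fields, or sums of such
  images.\<close>

lemma subspace_endo_im:
  assumes "endomorphism E T"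
  shows "subspace (endo_im E T p)"
proof (rule subspaceI)
  note T = endomorphismD[OF assms] and sub = subspace_tangent_space[of E p]
  show "0 \<in> endo_im E T p"
    unfolding endo_im_def
    by (rule image_eqI[of _ _ 0]) (simp_all add: endomorphism_zero_apply[OF assms] subspace_0[OF sub])
  show "x + y \<in> endo_im E T p" if "x \<in> endo_im E T p" "y \<in> endo_im E T p" for x y
  proof -
    from that obtain v w where "v \<in> tangent_space E p" "x = T p v" "w \<in> tangent_space E p" "y = T p w"
      unfolding endo_im_def by (elim imageE)
    then show ?thesis
      unfolding endo_im_def by (intro image_eqI[of _ _ "v + w"]) (simp_all add: T(2) subspace_add[OF sub])
  qed
  show "c *\<^sub>R x \<in> endo_im E T p" if "x \<in> endo_im E T p" for c x
  proof -
    from that obtain v where "v \<in> tangent_space E p" "x = T p v"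
      unfolding endo_im_def by (elim imageE)
    then show ?thesis
      unfolding endo_im_def by (intro image_eqI[of _ _ "c *\<^sub>R v"]) (simp_all add: T(3) subspace_scale[OF sub])
  qed
qed

text \<open>Two candidates for the projection differ by an element of both \<open>D p\<close> and
  \<open>K p\<close>, which makes the definite description unique.\<close>

lemma projector_eqI:
  assumes "subspace (D p)" "subspace (K p)" "D p \<inter> K p = {0}" "w \<in> D p" "v - w \<in> K p"
  shows "projector D K p v = w"
  unfolding projector_def
proof (rule the_equality)
  fix u assume u: "u \<in> D p \<and> v - u \<in> K p"
  have "w - u \<in> D p"
    using subspace_diff[OF assms(1,4)] u by blast
  moreover have "w - u \<in> K p"
    using subspace_diff[OF assms(2) conjunct2[OF u] assms(5)] by simp
  ultimately have "w - u \<in> {0}"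
    using assms(3) by blast
  then show "u = w" by simp
qed (use assms(4,5) in blast)

lemma subspace_set_plus:
  assumes "subspace S" "subspace T"
  shows "subspace (S + T)"
proof -
  have "S + T = {x + y |x y. x \<in> S \<and> y \<in> T}"
    by (auto simp: set_plus_def)
  then show ?thesis using subspace_sums[OF assms] by simp
qed

lemma subset_set_plus: "subspace T \<Longrightarrow> S \<subseteq> S + T"
  by (rule subsetI) (use set_plus_intro[of _ S 0 T] subspace_0[of T] in simp)

lemma subspace_set_sum:
  assumes "finite I" "\<And>i. i \<in> I \<Longrightarrow> subspace (S i)"
  shows "subspace (\<Sum>i\<in>I. S i)"
  using assms
  by (induction I rule: finite_induct) (auto simp: set_zero subspace_set_plus)

lemma mem_set_sum:
  assumes "finite I" "i \<in> I" "x \<in> S i" "\<And>i. i \<in> I \<Longrightarrow> subspace (S i)"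
  shows "x \<in> (\<Sum>i\<in>I. S i)"
proof -
  define s where "s j = (if j = i then x else 0)" for j
  have "x = sum s I" "\<forall>j\<in>I. s j \<in> S j"
    using assms by (simp_all add: s_def subspace_0)
  then show ?thesis
    unfolding set_sum_alt[OF assms(1)] by blast
qed

text \<open>\<open>W\<close> is the summand as large as each piece \<open>ZZ A\<close> of the other
  summand \<open>Z\<close>. It is left abstract so that it can be the vertical or the horizontal
  bundle.\<close>

lemma splitting_covariant_derivative:
  fixes E :: "('e::{t2_space, second_countable_topology}, 'm::real_normed_vector) chart set"
    and W Z :: "'e distr" and ZZ :: "'i \<Rightarrow> 'e distr" and SS QQ :: "'i \<Rightarrow> 'e endo"
  assumes E: "smooth_manifold E"
    and TWZ: "tangent_space E = W + Z" and WZ: "\<And>p. W p \<inter> Z p = {0}"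
    and fin: "finite I" and ne: "I \<noteq> {}"
    and dsum: "direct_sum Z ZZ I"
    and endos: "\<forall>A\<in>I. endomorphism E (SS A) \<and> endomorphism E (QQ A) \<and>
           endo_im E (SS A) = W \<and>
           endo_ker E (SS A) = W + (\<Sum>C\<in>I - {A}. ZZ C) \<and>
           endo_im E (QQ A) = ZZ A \<and>
           endo_ker E (QQ A) = Z \<and>
           endo_comp_eq E (QQ A) (SS A) (projector (ZZ A) (W + (\<Sum>C\<in>I - {A}. ZZ C))) \<and>
           endo_comp_eq E (SS A) (QQ A) (projector W Z)"
  defines "P \<equiv> (\<lambda>A. projector (ZZ A) (W + (\<Sum>C\<in>I - {A}. ZZ C)))"
    and "PW \<equiv> projector W Z"
    and "S \<equiv> (1 / sqrt (real (card I))) *\<^sub>R (\<Sum>A\<in>I. SS A)"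
    and "Q \<equiv> (1 / sqrt (real (card I))) *\<^sub>R (\<Sum>A\<in>I. QQ A)"
  defines "D \<equiv> (\<lambda>X Y. extension E PW (\<lambda>X Y. S \<cdot> lie_bracket E X (Q \<cdot> Y)) X (PW \<cdot> Y) +
      (\<Sum>A\<in>I. extension E (P A) (\<lambda>X Y. QQ A \<cdot> lie_bracket E X (SS A \<cdot> Y)) X (P A \<cdot> Y)))"
  shows "covariant_derivative E D"
    and "X \<in> vfields E \<Longrightarrow> Y \<in> vfields E \<Longrightarrow>
      D X Y = S \<cdot> lie_bracket E (PW \<cdot> X) (Q \<cdot> Y) +
        (\<Sum>A\<in>I. PW \<cdot> lie_bracket E (P A \<cdot> X) (PW \<cdot> Y)) +
        (\<Sum>A\<in>I. QQ A \<cdot> lie_bracket E (P A \<cdot> X) (SS A \<cdot> Y) +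
          P A \<cdot> lie_bracket E (X - P A \<cdot> X) (P A \<cdot> Y))"
proof -
  let ?T = "tangent_space E"
  have SS: "endomorphism E (SS A)" and QQ: "endomorphism E (QQ A)"
    and imS: "endo_im E (SS A) = W" and imQ: "endo_im E (QQ A) = ZZ A"
    and kerS: "endo_ker E (SS A) = W + (\<Sum>C\<in>I - {A}. ZZ C)" and kerQ: "endo_ker E (QQ A) = Z"
    and QS: "endo_comp_eq E (QQ A) (SS A) (P A)" and SQ: "endo_comp_eq E (SS A) (QQ A) PW"
    if "A \<in> I" for A
    using endos that by (auto simp: P_def PW_def)
  \<comment> \<open>Any one index will do: it exhibits \<open>W\<close> as an image and
    \<open>PW\<close> as a composite.\<close>
  obtain A0 where A0: "A0 \<in> I" using ne by blast
  have subW: "subspace (W p)" for p using subspace_endo_im[OF SS[OF A0]] imS[OF A0] by simp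
  have subZZ: "subspace (ZZ A p)" if "A \<in> I" for A p
    using subspace_endo_im[OF QQ[OF that]] imQ[OF that] by simp
  have Z_eq: "Z p = (\<Sum>A\<in>I. ZZ A p)" for p
    using dsum by (simp add: direct_sum_def sum_fun_apply)
  have subZ: "subspace (Z p)" for p
    unfolding Z_eq by (intro subspace_set_sum fin subZZ)
  have ZZ_Z: "ZZ A p \<subseteq> Z p" if "A \<in> I" for A p
    using mem_set_sum[OF fin that, of _ "\<lambda>A. ZZ A p"] subZZ unfolding Z_eq by blast
  define K where "K A = W + (\<Sum>C\<in>I - {A}. ZZ C)" for A
  have K_eq: "K A p = W p + (\<Sum>C\<in>I - {A}. ZZ C p)" for A p
    by (simp add: K_def sum_fun_apply)
  have sub_sum: "subspace (\<Sum>C\<in>I - {A}. ZZ C p)" for A p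
    by (intro subspace_set_sum) (use fin subZZ in auto)
  have subK: "subspace (K A p)" for A p
    unfolding K_eq by (intro subspace_set_plus subW sub_sum)
  have W_K: "W p \<subseteq> K A p" for A p
    unfolding K_eq by (rule subset_set_plus[OF sub_sum])
  have ZZ_K: "ZZ C p \<subseteq> K A p" if "C \<in> I" "C \<noteq> A" for A C p
  proof
    fix x assume "x \<in> ZZ C p"
    then have "x \<in> (\<Sum>C\<in>I - {A}. ZZ C p)"
      using fin that subZZ by (intro mem_set_sum[of _ C]) auto
    then show "x \<in> K A p"
      using subset_set_plus[OF subW] unfolding K_eq add.commute[of "W p"] by blast
  qed
  \<comment> \<open>\<open>direct_sum\<close> separates \<open>ZZ A\<close> only from the other
    pieces. The \<open>W\<close>-component of a common element is a difference of elements of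
    \<open>Z\<close>, so it lies in \<open>W p \<inter> Z p\<close> and vanishes, which reduces the
    claim to \<open>direct_sum\<close>.\<close>
  have ZZK: "ZZ A p \<inter> K A p = {0}" if A: "A \<in> I" for A p
  proof -
    have "x = 0" if x: "x \<in> ZZ A p" "x \<in> K A p" for x
    proof -
      obtain w z where wz: "x = w + z" "w \<in> W p" "z \<in> (\<Sum>C\<in>I - {A}. ZZ C p)"
        using x(2) unfolding K_eq by (rule set_plus_elim)
      then obtain s where s: "z = sum s (I - {A})" "\<forall>C\<in>I - {A}. s C \<in> ZZ C p"
        using fin by (auto simp: set_sum_alt)
      have "z \<in> Z p"
        unfolding s(1) by (intro subspace_sum[OF subZ]) (use s(2) ZZ_Z in auto)
      then have "x - z \<in> Z p" using subspace_diff[OF subZ] x(1) ZZ_Z[OF A] by blast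
      then have "w = 0" using wz WZ[of p] by auto
      then show ?thesis
        using dsum A x(1) wz by (auto simp: direct_sum_def sum_fun_apply)
    qed
    then show ?thesis using subspace_0[OF subZZ[OF A]] subspace_0[OF subK] by auto
  qed
  have PS: "QQ A p (SS A p v) = P A p v" if "A \<in> I" "v \<in> ?T p" for A p v
    using QS that by (simp add: endo_comp_eq_def)
  have PQ: "SS A p (QQ A p v) = PW p v" if "A \<in> I" "v \<in> ?T p" for A p v
    using SQ that by (simp add: endo_comp_eq_def)
  have endP: "endomorphism E (P A)" if "A \<in> I" for A
    using endomorphism_comp QQ SS QS that by blast
  have endPW: "endomorphism E PW"
    using endomorphism_comp QQ SS SQ A0 by blast
  note [simp] = endomorphismD(1)[OF SS] endomorphismD(1)[OF QQ] endomorphismD(1)[OF endP]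
    endomorphismD(1)[OF endPW]

  \<comment> \<open>The projectors pick out the components of one chosen decomposition of
    \<open>v\<close>: removing the component \<open>s A\<close> leaves an element of
    \<open>K A\<close>.\<close>
  have total: "PW p v + (\<Sum>A\<in>I. P A p v) = v" if v: "v \<in> ?T p" for p v
  proof -
    obtain w z where wz: "v = w + z" "w \<in> W p" "z \<in> Z p"
      using v TWZ by (auto simp: set_plus_def)
    then obtain s where s: "z = sum s I" "\<forall>C\<in>I. s C \<in> ZZ C p"
      using fin by (auto simp: Z_eq set_sum_alt)
    have "PW p v = w"
      unfolding PW_def using wz by (intro projector_eqI subW subZ WZ) auto
    moreover have "P A p v = s A" if A: "A \<in> I" for A
      unfolding P_def
    proof (rule projector_eqI)
      have "v - s A = w + sum s (I - {A})"
        using fin A by (simp add: wz(1) s(1) sum.remove)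
      also have "\<dots> \<in> K A p"
        using W_K wz(2) ZZ_K s(2)
        by (intro subspace_add[OF subK] subspace_sum[OF subK]) blast+
      finally show "v - s A \<in> (W + (\<Sum>C\<in>I - {A}. ZZ C)) p" by (simp add: K_def)
    qed (use A s subZZ subK ZZK in \<open>auto simp: K_def\<close>)
    ultimately show ?thesis using wz s by simp
  qed

  have S_W: "SS A p x = 0" if "A \<in> I" "x \<in> W p" for A p x
  proof -
    have "x \<in> endo_ker E (SS A) p"
      using that(2) W_K[of p A] unfolding kerS[OF that(1)] K_def by blast
    then show ?thesis by (simp add: endo_ker_def)
  qed
  have S_in: "SS A p v \<in> W p" if "A \<in> I" "v \<in> ?T p" for A p v
    unfolding imS[OF that(1), symmetric] endo_im_def using that(2) by (rule imageI)
  have Q_in: "QQ A p v \<in> ZZ A p" if "A \<in> I" "v \<in> ?T p" for A p v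
    unfolding imQ[OF that(1), symmetric] endo_im_def using that(2) by (rule imageI)
  have SS0: "SS A p (SS B p v) = 0" if "A \<in> I" "B \<in> I" "v \<in> ?T p" for A B p v
    by (rule S_W[OF that(1) S_in[OF that(2,3)]])
  have QQ0: "QQ A p (QQ B p v) = 0" if "A \<in> I" "B \<in> I" "v \<in> ?T p" for A B p v
  proof -
    have "QQ B p v \<in> endo_ker E (QQ A) p"
      using Q_in[OF that(2,3)] ZZ_Z[OF that(2)] unfolding kerQ[OF that(1)] by blast
    then show ?thesis by (simp add: endo_ker_def)
  qed
  have SQ0: "SS A p (QQ B p v) = 0" if "A \<in> I" "B \<in> I" "A \<noteq> B" "v \<in> ?T p" for A B p v
  proof -
    have "QQ B p v \<in> endo_ker E (SS A) p"
      using Q_in[OF that(2,4)] ZZ_K[OF that(2) that(3)[symmetric]]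
      unfolding kerS[OF that(1)] K_def by blast
    then show ?thesis by (simp add: endo_ker_def)
  qed

  \<comment> \<open>\<open>SS A\<close> is applied to the resolution of the identity
    \<open>total\<close>. It kills the \<open>PW\<close> term and every \<open>P B\<close> with
    \<open>B \<noteq> A\<close>, as these end in \<open>SS\<close> or in
    \<open>QQ B\<close>.\<close>
  have S_P: "SS A p (P A p v) = SS A p v" if "A \<in> I" "v \<in> ?T p" for A p v
  proof -
    have "SS A p v = SS A p (PW p v + (\<Sum>B\<in>I. P B p v))" using total that by simp
    also have "\<dots> = SS A p (PW p v) + (\<Sum>B\<in>I. SS A p (P B p v))"
      using that by (simp add: endomorphismD(2)[OF SS] endomorphism_sum_apply[OF SS]
          subspace_sum[OF subspace_tangent_space])
    also have "SS A p (PW p v) = 0"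
      using that by (simp add: PQ[OF A0, symmetric] SS0 A0)
    also have "(\<Sum>B\<in>I. SS A p (P B p v)) = (\<Sum>B\<in>I. if B = A then SS A p (P A p v) else 0)"
      using that by (intro sum.cong refl) (auto simp: PS[symmetric] SQ0)
    finally show ?thesis using fin that by simp
  qed
  have Q_PW: "QQ A p (PW p v) = QQ A p v" if "A \<in> I" "v \<in> ?T p" for A p v
  proof -
    have "QQ A p v = QQ A p (PW p v + (\<Sum>B\<in>I. P B p v))" using total that by simp
    also have "\<dots> = QQ A p (PW p v) + (\<Sum>B\<in>I. QQ A p (P B p v))"
      using that by (simp add: endomorphismD(2)[OF QQ] endomorphism_sum_apply[OF QQ]
          subspace_sum[OF subspace_tangent_space])
    also have "(\<Sum>B\<in>I. QQ A p (P B p v)) = 0"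
      using that by (intro sum.neutral ballI) (simp add: PS[symmetric] QQ0)
    finally show ?thesis by simp
  qed
  \<comment> \<open>Idempotence is read off from the composite \<open>QQ A\<close>,
    \<open>SS A\<close> by absorbing the inner \<open>P A\<close> into \<open>SS A\<close>.\<close>
  have P_P: "P A p (P A p v) = P A p v" if "A \<in> I" "v \<in> ?T p" for A p v
    using that PS[of A "P A p v" p] PS[of A v p] S_P[of A v p] by simp
  have Q_P: "QQ A p (P A p v) = 0" if "A \<in> I" "v \<in> ?T p" for A p v
    using that by (simp add: PS[symmetric] QQ0)
  have QSP: "QQ A p (SS A p (P A p v)) = P A p v" if "A \<in> I" "v \<in> ?T p" for A p v
    using that by (simp add: S_P PS)
  have PW_PW: "PW p (PW p v) = PW p v" if "v \<in> ?T p" for p v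
    using that PQ[OF A0, of "PW p v" p] PQ[OF A0, of v p] Q_PW[OF A0, of v p] by simp

  have S_app: "S p v = (1 / sqrt (real (card I))) *\<^sub>R (\<Sum>A\<in>I. SS A p v)"
    and Q_app: "Q p v = (1 / sqrt (real (card I))) *\<^sub>R (\<Sum>A\<in>I. QQ A p v)" for p v
    by (simp_all add: S_def Q_def scaleR_fun_def sum_fun_apply)
  have endS: "endomorphism E S" and endQ: "endomorphism E Q"
    unfolding S_def Q_def by (intro endomorphism_scaleR endomorphism_sum E SS QQ; assumption)+
  have S_PW: "S p (PW p v) = 0" if "v \<in> ?T p" for p v
    using that by (simp add: S_app PQ[OF A0, symmetric] SS0 A0)
  have Q_PW': "Q p (PW p v) = Q p v" if "v \<in> ?T p" for p v
    using that by (simp add: Q_app Q_PW)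
  have S_Q: "S p (Q p v) = PW p v" if v: "v \<in> ?T p" for p v
  proof -
    let ?c = "1 / sqrt (real (card I))"
    have *: "SS A p (\<Sum>B\<in>I. QQ B p v) = PW p v" if A: "A \<in> I" for A
    proof -
      have "SS A p (\<Sum>B\<in>I. QQ B p v) = (\<Sum>B\<in>I. SS A p (QQ B p v))"
        using v by (simp add: endomorphism_sum_apply[OF SS[OF A]])
      also have "\<dots> = (\<Sum>B\<in>I. if B = A then PW p v else 0)"
        using v A by (intro sum.cong refl) (auto simp: PQ SQ0)
      finally show ?thesis using fin A by simp
    qed
    have "(\<Sum>B\<in>I. QQ B p v) \<in> ?T p"
      using v by (intro subspace_sum[OF subspace_tangent_space]) simp
    then have "S p (Q p v) = ?c *\<^sub>R (\<Sum>A\<in>I. ?c *\<^sub>R PW p v)"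
      unfolding S_app Q_app by (simp add: endomorphismD(3)[OF SS] *)
    \<comment> \<open>Functions also carry a pointwise ring structure, in which
      \<open>sum_constant\<close> would produce a product; the scalar form is wanted
      instead.\<close>
    also have "\<dots> = (?c * ?c * real (card I)) *\<^sub>R PW p v"
      by (simp add: sum_constant_scaleR del: sum_constant)
    also have "?c * ?c * real (card I) = 1"
      using fin ne by simp
    finally show ?thesis by simp
  qed
  \<comment> \<open>The triples \<open>L\<close>, \<open>M\<close>, \<open>P\<close> are
    \<open>S\<close>, \<open>Q\<close>, \<open>PW\<close> and, for each \<open>A\<close>,
    \<open>QQ A\<close>, \<open>SS A\<close>, \<open>P A\<close>. The sum is first taken over
    operators and evaluated at \<open>X\<close> and \<open>Y\<close> later.\<close>
  have "partial_cov_deriv E (PW + (\<Sum>A\<in>I. P A))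
    ((\<lambda>X Y. extension E PW (\<lambda>X Y. S \<cdot> lie_bracket E X (Q \<cdot> Y)) X (PW \<cdot> Y)) +
     (\<Sum>A\<in>I. (\<lambda>X Y. extension E (P A) (\<lambda>X Y. QQ A \<cdot> lie_bracket E X (SS A \<cdot> Y)) X (P A \<cdot> Y))))"
    by (intro partial_cov_deriv_add partial_cov_deriv_sum partial_cov_deriv_extension E SS QQ
        endP endPW endS endQ)
      (simp_all add: S_PW Q_PW' S_Q PW_PW P_P Q_P QSP)
  moreover have "(PW + (\<Sum>A\<in>I. P A)) \<cdot> Y = Y" if "Y \<in> vfields E" for Y
    using total[OF vfieldsD(1)[OF that]] by (simp add: endo_app_def fun_eq_iff sum_fun_apply)
  ultimately have "covariant_derivative E
    ((\<lambda>X Y. extension E PW (\<lambda>X Y. S \<cdot> lie_bracket E X (Q \<cdot> Y)) X (PW \<cdot> Y)) +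
     (\<Sum>A\<in>I. (\<lambda>X Y. extension E (P A) (\<lambda>X Y. QQ A \<cdot> lie_bracket E X (SS A \<cdot> Y)) X (P A \<cdot> Y))))"
    by (rule covariant_derivative_if_partial)
  then show "covariant_derivative E D"
    by (simp add: D_def plus_fun_def sum_fun_apply)

  assume X: "X \<in> vfields E" and Y: "Y \<in> vfields E"
  \<comment> \<open>By \<open>total\<close>, the complement of \<open>PW \<cdot> X\<close> splits
    into its pieces, so the single extension term for \<open>PW\<close> becomes the sum over
    \<open>A\<close> of the explicit formula.\<close>
  have "X - PW \<cdot> X = (\<Sum>A\<in>I. P A \<cdot> X)"
    using total[OF vfieldsD(1)[OF X]]
    by (simp add: endo_app_def fun_eq_iff sum_fun_apply algebra_simps)
  moreover have "PW \<cdot> lie_bracket E (\<Sum>A\<in>I. P A \<cdot> X) (PW \<cdot> Y) =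
      (\<Sum>A\<in>I. PW \<cdot> lie_bracket E (P A \<cdot> X) (PW \<cdot> Y))"
    using X Y E endomorphismD(4)[OF endP] endomorphismD(4)[OF endPW]
    by (simp add: lie_bracket_sum_left endo_app_sum[OF endPW] lie_bracket_vfields)
  \<comment> \<open>This and the next identity remove the inner projectors, which the explicit
    formula does not contain after \<open>Q\<close> and \<open>SS A\<close>.\<close>
  moreover have "Q \<cdot> PW \<cdot> Y = Q \<cdot> Y"
    using vfieldsD(1)[OF Y] by (simp add: endo_app_def fun_eq_iff Q_PW')
  moreover have "SS A \<cdot> P A \<cdot> Y = SS A \<cdot> Y" if "A \<in> I" for A
    using vfieldsD(1)[OF Y] that by (simp add: endo_app_def fun_eq_iff S_P)
  ultimately show "D X Y = S \<cdot> lie_bracket E (PW \<cdot> X) (Q \<cdot> Y) +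
        (\<Sum>A\<in>I. PW \<cdot> lie_bracket E (P A \<cdot> X) (PW \<cdot> Y)) +
        (\<Sum>A\<in>I. QQ A \<cdot> lie_bracket E (P A \<cdot> X) (SS A \<cdot> Y) +
          P A \<cdot> lie_bracket E (X - P A \<cdot> X) (P A \<cdot> Y))"
    by (simp add: D_def extension_def)
qed

theorem theorem4p2:
  fixes E :: "('e::{t2_space, second_countable_topology}, 'm::real_normed_vector) chart set"
    and B :: "('b::{t2_space, second_countable_topology}, 'n::real_normed_vector) chart set"
    and \<pi> :: "'e \<Rightarrow> 'b"
    and H :: "'e distr"
    and N :: nat
  assumes "fibred_manifold E B \<pi>"
    and "ehresmann_connection E \<pi> H"
    and "N > 0"
  shows
    "let V = vertical E \<pi>; PV = projector V H; PH = projector H V; I = {1..N};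
         br = lie_bracket E
     in
      (\<forall>HH SS QQ :: nat \<Rightarrow> _.
        let P = (\<lambda>A. projector (HH A) (V + (\<Sum>C\<in>I - {A}. HH C))) in
        (\<forall>p. manifold_dim B = N * dim (V p)) \<longrightarrow>
        (\<forall>A\<in>I. \<exists>k. distribution E k (HH A) \<and> (\<forall>p. k = dim (V p))) \<longrightarrow>
        direct_sum H HH I \<longrightarrow>
        (\<forall>A\<in>I. endomorphism E (SS A) \<and> endomorphism E (QQ A) \<and>
           endo_im E (SS A) = V \<and>
           endo_ker E (SS A) = V + (\<Sum>C\<in>I - {A}. HH C) \<and>
           endo_im E (QQ A) = HH A \<and>
           endo_ker E (QQ A) = H \<and>
           endo_comp_eq E (QQ A) (SS A) (P A) \<and>
           endo_comp_eq E (SS A) (QQ A) PV) \<longrightarrow>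
        (let S = (1 / sqrt (real N)) *\<^sub>R (\<Sum>A\<in>I. SS A);
             Q = (1 / sqrt (real N)) *\<^sub>R (\<Sum>A\<in>I. QQ A);
             nablaV = (\<lambda>X Y. S \<cdot> br X (Q \<cdot> Y));
             nablaA = (\<lambda>A X Y. QQ A \<cdot> br X (SS A \<cdot> Y));
             nabla = (\<lambda>X Y. extension E PV nablaV X (PV \<cdot> Y) +
                        (\<Sum>A\<in>I. extension E (P A) (nablaA A) X (P A \<cdot> Y)))
         in
           covariant_derivative E nabla \<and>
           (\<forall>X\<in>vfields E. \<forall>Y\<in>vfields E.
              nabla X Y = S \<cdot> br (PV \<cdot> X) (Q \<cdot> Y) +
                (\<Sum>A\<in>I. PV \<cdot> br (P A \<cdot> X) (PV \<cdot> Y)) +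
                (\<Sum>A\<in>I. QQ A \<cdot> br (P A \<cdot> X) (SS A \<cdot> Y) +
                         P A \<cdot> br (X - P A \<cdot> X) (P A \<cdot> Y))))) \<and>
      (\<forall>VV SS QQ :: nat \<Rightarrow> _.
        let P = (\<lambda>A. projector (VV A) (H + (\<Sum>C\<in>I - {A}. VV C))) in
        (\<forall>p. dim (V p) = N * manifold_dim B) \<longrightarrow>
        (\<forall>A\<in>I. \<exists>k. distribution E k (VV A) \<and> (\<forall>p. k = dim (H p))) \<longrightarrow>
        direct_sum V VV I \<longrightarrow>
        (\<forall>A\<in>I. endomorphism E (SS A) \<and> endomorphism E (QQ A) \<and>
           endo_im E (SS A) = VV A \<and>
           endo_ker E (SS A) = V \<and>
           endo_im E (QQ A) = H \<and>
           endo_ker E (QQ A) = H + (\<Sum>C\<in>I - {A}. VV C) \<and>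
           endo_comp_eq E (SS A) (QQ A) (P A) \<and>
           endo_comp_eq E (QQ A) (SS A) PH) \<longrightarrow>
        (let S = (1 / sqrt (real N)) *\<^sub>R (\<Sum>A\<in>I. SS A);
             Q = (1 / sqrt (real N)) *\<^sub>R (\<Sum>A\<in>I. QQ A);
             nablaH = (\<lambda>X Y. Q \<cdot> br X (S \<cdot> Y));
             nablaA = (\<lambda>A X Y. SS A \<cdot> br X (QQ A \<cdot> Y));
             nabla = (\<lambda>X Y. extension E PH nablaH X (PH \<cdot> Y) +
                        (\<Sum>A\<in>I. extension E (P A) (nablaA A) X (P A \<cdot> Y)))
         in
           covariant_derivative E nabla \<and>
           (\<forall>X\<in>vfields E. \<forall>Y\<in>vfields E.
              nabla X Y = Q \<cdot> br (PH \<cdot> X) (S \<cdot> Y) +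
                (\<Sum>A\<in>I. PH \<cdot> br (P A \<cdot> X) (PH \<cdot> Y)) +
                (\<Sum>A\<in>I. SS A \<cdot> br (P A \<cdot> X) (QQ A \<cdot> Y) +
                         P A \<cdot> br (X - P A \<cdot> X) (P A \<cdot> Y)))))"
proof -
  define V where "V = vertical E \<pi>"
  have E: "smooth_manifold E" using assms(1) by (simp add: fibred_manifold_def)
  have VH: "tangent_space E = V + H" "V p \<inter> H p = {0}" for p
    using assms(2) by (auto simp: ehresmann_connection_def V_def)
  have HV: "tangent_space E = H + V" "H p \<inter> V p = {0}" for p
    using VH by (auto simp: add.commute)
  have I: "finite {1..N}" "{1..N} \<noteq> {}" "card {1..N} = N" using assms(3) by auto
  show ?thesis
    unfolding Let_def V_def[symmetric]
  proof (intro conjI allI impI, goal_cases)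
    case (1 HH SS QQ)
    then show ?case
      using splitting_covariant_derivative(1)[OF E VH I(1,2), of HH SS QQ] by (simp add: I(3))
  next
    case (2 HH SS QQ)
    then show ?case
      using splitting_covariant_derivative(2)[OF E VH I(1,2), of HH SS QQ] by (simp add: I(3))
  next
    \<comment> \<open>For the second part the horizontal bundle takes the place of \<open>W\<close>,
      and \<open>QQ\<close> and \<open>SS\<close> are passed in exchanged order.\<close>
    case (3 VV SS QQ)
    then show ?case
      using splitting_covariant_derivative(1)[OF E HV I(1,2), of VV QQ SS] by (simp add: I(3))
  next
    case (4 VV SS QQ)
    then show ?case
      using splitting_covariant_derivative(2)[OF E HV I(1,2), of VV QQ SS] by (simp add: I(3))
  qed
qed

end
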